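(* Let $q$ be an odd prime power, and fix a Singer group $C=\langle R\rangle\le\mathrm{PGL}_2(q)$ and a base point $P_0\in\mathbb P^1(\mathbb F_q)$; put $J=R^{(q+1)/2}$. Then exactly $$q(q^2-1)-2(q+1)$$ projectivities $M\in\mathrm{PGL}_2(q)$ satisfy $MJ\neq JM$, and hence induce APN permutations $F_M$ of $\mathbb Z_{q+1}$. Moreover, distinct projectivities $M$ induce distinct permutations $F_M$ for the fixed choices of $R$ and $P_0$.
   Context: $\mathbb Z_n=\mathbb Z/n\mathbb Z$. The differential uniformity of $F:\mathbb Z_n\to\mathbb Z_n$ is $\delta(F)=\max_{u\neq 0,\,v\in\mathbb Z_n}\#\{x\in\mathbb Z_n: F(x+u)-F(x)=v\}$, and $F$ is called APN if $\delta(F)=2$. $\mathrm{PGL}_2(q)=\mathrm{GL}_2(q)/\{\lambda I:\lambda\in\mathbb F_q^*\}$ acts on the projective line $\mathbb P^1(\mathbb F_q)$ (the set of one-dimensional subspaces of $\mathbb F_q^2$, of size $q+1$). A projectivity is an element of $\mathrm{PGL}_2(q)$. A Singer group is a cyclic subgroup $C\le\mathrm{PGL}_2(q)$ of order $q+1$; it acts regularly on $\mathbb P^1(\mathbb F_q)$. Let $q$ be an odd prime power and $n=q+1$. Fix a generator $R$ of $C$ and a base point $P_0\in\mathbb P^1(\mathbb F_q)$. The map $\exp_{R,P_0}:\mathbb Z_n\to\mathbb P^1(\mathbb F_q)$, $i\mapsto R^iP_0$, is a bijection, with inverse denoted $\log_{R,P_0}$. $J=R^{n/2}$ is the unique element of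 order two in $C$. For $M\in\mathrm{PGL}_2(q)$ define the permutation $F_M=\log_{R,P_0}\circ M\circ\exp_{R,P_0}$ of $\mathbb Z_n$; that is, $F_M(i)=j$ iff $M(R^iP_0)=R^jP_0$. *)

theory Defs
  imports
    "HOL-Analysis.Analysis"
    "HOL-Algebra.Algebra"
    "HOL-Number_Theory.Residues"
begin

definition diff_uniformity :: "nat \<Rightarrow> (int \<Rightarrow> int) \<Rightarrow> nat" where
  "diff_uniformity n F =
     (let Z = residue_ring (int n) in
      Max {card {x \<in> carrier Z. F (x \<oplus>\<^bsub>Z\<^esub> u) \<ominus>\<^bsub>Z\<^esub> F x = v} | u v.
             u \<in> carrier Z \<and> u \<noteq> \<zero>\<^bsub>Z\<^esub> \<and> v \<in> carrier Z})"

definition is_APN :: "nat \<Rightarrow> (int \<Rightarrow> int) \<Rightarrow> bool" where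
  "is_APN n F \<longleftrightarrow> diff_uniformity n F = 2"

definition GL2 :: "('a::field ^ 2 ^ 2) monoid" where
  "GL2 = \<lparr>carrier = {A. invertible A}, monoid.mult = (**), one = mat 1\<rparr>"

(* mat c is the scalar matrix c * I *)
definition scalars2 :: "('a::field ^ 2 ^ 2) set" where
  "scalars2 = {mat c | c. c \<noteq> 0}"

definition PGL2 :: "('a::field ^ 2 ^ 2) set monoid" where
  "PGL2 = GL2 Mod scalars2"

definition proj_line :: "('a::field ^ 2) set set" where
  "proj_line = {L. vec.subspace L \<and> vec.dim L = 1}"

(* A projectivity M is a coset of matrices. All matrices in M map the line L onto the same
   line, so the union below is the image of L under any one of them; see pgl_act_rcoset. *)
definition pgl_act :: "('a::field ^ 2 ^ 2) set \<Rightarrow> ('a ^ 2) set \<Rightarrow> ('a ^ 2) set" where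
  "pgl_act M L = (\<Union>A\<in>M. (\<lambda>v. A *v v) ` L)"

definition singer_group :: "('a::{field,finite} ^ 2 ^ 2) set set \<Rightarrow> bool" where
  "singer_group C \<longleftrightarrow>
     subgroup C PGL2 \<and> cyclic_group (PGL2\<lparr>carrier := C\<rparr>) \<and> card C = CARD('a) + 1"

definition proj_exp ::
    "('a::{field,finite} ^ 2 ^ 2) set \<Rightarrow> ('a ^ 2) set \<Rightarrow> int \<Rightarrow> ('a ^ 2) set" where
  "proj_exp R P0 i = pgl_act (R [^]\<^bsub>PGL2\<^esub> i) P0"

definition proj_log ::
    "('a::{field,finite} ^ 2 ^ 2) set \<Rightarrow> ('a ^ 2) set \<Rightarrow> ('a ^ 2) set \<Rightarrow> int" where
  "proj_log R P0 = inv_into (carrier (residue_ring (int (CARD('a) + 1)))) (proj_exp R P0)"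

(* Restricting to the residues makes equality of two such maps mean equality as maps on
   the integers modulo CARD('a) + 1. *)
definition proj_perm ::
    "('a::{field,finite} ^ 2 ^ 2) set \<Rightarrow> ('a ^ 2) set \<Rightarrow> ('a ^ 2 ^ 2) set \<Rightarrow> int \<Rightarrow> int" where
  "proj_perm R P0 M =
     restrict (proj_log R P0 \<circ> pgl_act M \<circ> proj_exp R P0)
       (carrier (residue_ring (int (CARD('a) + 1))))"

lemma mat_mult_vec: "mat c *v v = c *s v" for v :: "'a::field ^ 'n"
  by (simp add: matrix_vector_mult_def mat_def vec_eq_iff if_distrib[of "\<lambda>x. x * _"]
      cong: if_cong)

lemma mat_mult_mat_vec: "(mat c ** A) *v v = c *s (A *v v)" for A :: "'a::field ^ 'n ^ 'n"
  by (metis matrix_vector_mul_assoc mat_mult_vec)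

lemma mult_mat_vec: "(A ** mat c) *v v = c *s (A *v v)" for A :: "'a::field ^ 'n ^ 'n"
  by (metis matrix_vector_mul_assoc mat_mult_vec vec.scale)

lemma mat_mult_mat: "mat a ** mat b = (mat (a * b) :: 'a::field ^ 'n ^ 'n)"
  unfolding matrix_eq mat_mult_mat_vec mat_mult_vec by simp

lemma mat_mult_commute: "mat c ** A = A ** mat c" for A :: "'a::field ^ 'n ^ 'n"
  unfolding matrix_eq mat_mult_mat_vec mult_mat_vec by simp

lemma invertible_mat: "c \<noteq> 0 \<Longrightarrow> invertible (mat c :: 'a::field ^ 'n ^ 'n)"
  unfolding invertible_def
  by (rule exI[of _ "mat (inverse c)"]) (simp add: mat_mult_mat)

lemma group_GL2: "group (GL2 :: ('a::field ^ 2 ^ 2) monoid)"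
proof (rule groupI)
  fix A :: "'a ^ 2 ^ 2"
  assume "A \<in> carrier GL2"
  then obtain B where "A ** B = mat 1" "B ** A = mat 1"
    unfolding GL2_def invertible_def by auto
  then show "\<exists>B\<in>carrier GL2. B \<otimes>\<^bsub>GL2\<^esub> A = \<one>\<^bsub>GL2\<^esub>"
    unfolding GL2_def invertible_def by auto
qed (simp_all add: GL2_def invertible_mult invertible_mat matrix_mul_assoc)

lemma normal_scalars2: "scalars2 \<lhd> (GL2 :: ('a::field ^ 2 ^ 2) monoid)"
proof -
  interpret group "GL2 :: ('a ^ 2 ^ 2) monoid" by (rule group_GL2)
  have "subgroup scalars2 (GL2 :: ('a ^ 2 ^ 2) monoid)"
  proof (rule subgroupI)
    fix A :: "'a ^ 2 ^ 2"
    assume "A \<in> scalars2"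
    then obtain c where c: "A = mat c" "c \<noteq> 0" by (auto simp: scalars2_def)
    have "inv\<^bsub>GL2\<^esub> A = mat (inverse c)"
      using c by (intro inv_equality) (auto simp: GL2_def mat_mult_mat invertible_mat)
    then show "inv\<^bsub>GL2\<^esub> A \<in> scalars2"
      using c by (auto simp: scalars2_def)
  next
    fix A B :: "'a ^ 2 ^ 2"
    assume "A \<in> scalars2" "B \<in> scalars2"
    then show "A \<otimes>\<^bsub>GL2\<^esub> B \<in> scalars2"
      by (force simp: scalars2_def GL2_def mat_mult_mat)
  qed (auto simp: scalars2_def GL2_def invertible_mat intro: exI[of _ 1])
  then show ?thesis
    by (rule normalI)
      (auto simp: r_coset_def l_coset_def GL2_def scalars2_def mat_mult_commute)
qed

lemma group_PGL2: "group (PGL2 :: ('a::field ^ 2 ^ 2) set monoid)"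
  unfolding PGL2_def by (rule normal.factorgroup_is_group[OF normal_scalars2])

lemma pgl_act_rcoset:
  fixes A :: "'a::field ^ 2 ^ 2"
  assumes "vec.subspace L"
  shows "pgl_act (scalars2 #>\<^bsub>GL2\<^esub> A) L = (\<lambda>v. A *v v) ` L"
proof (rule subset_antisym; rule subsetI)
  fix w
  assume "w \<in> pgl_act (scalars2 #>\<^bsub>GL2\<^esub> A) L"
  then obtain c v where "v \<in> L" "w = (mat c ** A) *v v"
    unfolding pgl_act_def r_coset_def GL2_def scalars2_def by auto
  moreover from this have "w = A *v (c *s v)"
    by (simp add: mat_mult_mat_vec vec.scale)
  ultimately show "w \<in> (\<lambda>v. A *v v) ` L"
    using assms vec.subspace_scale by blast
next
  fix w
  assume "w \<in> (\<lambda>v. A *v v) ` L"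
  moreover have "mat 1 ** A \<in> scalars2 #>\<^bsub>GL2\<^esub> A"
    unfolding r_coset_def GL2_def scalars2_def
    by (simp, rule exI[of _ "mat 1"], simp, rule exI[of _ 1], simp)
  ultimately show "w \<in> pgl_act (scalars2 #>\<^bsub>GL2\<^esub> A) L"
    unfolding pgl_act_def by auto
qed

end

theory Submission
  imports Defs
begin

text \<open>
  Let \<open>F\<close> be the permutation of the residues modulo \<open>n = q + 1\<close> induced by \<open>M\<close>. In terms of the
  points \<open>P = R^x P0\<close>, the equation \<open>F (x + u) - F x = v\<close> says \<open>M R^u P = R^v M P\<close>. Two
  different projectivities agree on at most two points (\<open>proj_eqI_three_points\<close>), so a
  difference can occur more than twice only if \<open>M R^u = R^v M\<close>. Such a relation with \<open>u \<noteq> 0\<close>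
  forces \<open>M\<close> to commute with the involution \<open>J\<close>: the matrices commuting with a nontrivial power
  of \<open>R\<close> form a quadratic extension field, \<open>J\<close> and its conjugate by \<open>M\<close> are represented in this
  field by square roots of the same scalar, and these agree up to sign
  (\<open>intertwiner_commutes_with_involution\<close>). Hence for \<open>M J \<noteq> J M\<close> no difference occurs more than
  twice. Some difference does occur twice, because the \<open>n\<close> differences for a fixed shift avoid
  zero (\<open>is_APN_permutationI\<close>).

  The same bound on agreement shows that \<open>M\<close> is determined by \<open>F\<close>, as there are \<open>q + 1 \<ge> 4\<close>
  points.

  All of this rests on the regularity of the action of the Singer group, which has to be derived
  from the order of \<open>R\<close>. If a matrix of \<open>R\<close> had an eigenvector, the order of \<open>R\<close> would divide
  \<open>q (q - 1)\<close>, which \<open>q + 1\<close> does not (\<open>singer_matrix\<close>). A matrix without eigenvectors has the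
  same property for all its nonscalar powers (\<open>eigenfree_pow\<close>), so the action is semiregular,
  and it is regular as there are at most \<open>q + 1\<close> points.

  For the number of admissible \<open>M\<close>, matrices are counted instead of projectivities, each of which
  has \<open>q - 1\<close> representatives. There are \<open>(q\<^sup>2 - 1) (q\<^sup>2 - q)\<close> invertible matrices. The
  projectivities centralizing \<open>J\<close> are given by the nonzero matrices that commute or anticommute
  with a matrix of \<open>J\<close>, and both kinds are \<open>q\<^sup>2 - 1\<close> in number (\<open>card_centralizer\<close>).
\<close>

section \<open>Linear algebra of the plane\<close>

text \<open>The determinant of the matrix with rows \<open>v\<close> and \<open>w\<close>; it detects proportional vectors and
  gives coordinates by Cramer's rule.\<close>

definition cross :: "'a::field ^ 2 \<Rightarrow> 'a ^ 2 \<Rightarrow> 'a" where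
  "cross v w = v $ 1 * w $ 2 - v $ 2 * w $ 1"

lemma cross_eq_0_iff: "v \<noteq> 0 \<Longrightarrow> cross v w = 0 \<longleftrightarrow> (\<exists>c. w = c *s v)"
proof
  assume v: "v \<noteq> 0" and z: "cross v w = 0"
  show "\<exists>c. w = c *s v"
  proof (cases "v $ 1 = 0")
    case True
    with v have "v $ 2 \<noteq> 0" by (auto simp: vec_eq_iff forall_2)
    with True z show ?thesis
      by (intro exI[of _ "w $ 2 / v $ 2"]) (auto simp: cross_def vec_eq_iff forall_2)
  next
    case False
    with z show ?thesis
      by (intro exI[of _ "w $ 1 / v $ 1"]) (auto simp: cross_def vec_eq_iff forall_2 field_simps)
  qed
qed (auto simp: cross_def)

lemma cramer2:
  assumes "cross v w \<noteq> 0"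
  obtains a b where "x = a *s v + b *s w"
proof
  show "x = (cross x w / cross v w) *s v + (cross v x / cross v w) *s w"
    using assms by (auto simp: vec_eq_iff forall_2 divide_simps) (auto simp: cross_def algebra_simps)
qed

lemma matrix_eqI_basis:
  fixes A B :: "'a::field ^ 2 ^ 2"
  assumes "cross v w \<noteq> 0" and "A *v v = B *v v" and "A *v w = B *v w"
  shows "A = B"
  unfolding matrix_eq
proof
  fix x
  obtain a b where "x = a *s v + b *s w" using cramer2[OF assms(1)] by blast
  then show "A *v x = B *v x" using assms(2,3) by (simp add: vec.add vec.scale)
qed

text \<open>The irreducibility of the characteristic polynomial of a matrix of size two, in the form in
  which it is used: \<open>v\<close> and \<open>T *v v\<close> form a basis for every \<open>v \<noteq> 0\<close>, and the projectivity
  of \<open>T\<close> has no fixed point.\<close>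

definition eigenfree :: "'a::field ^ 2 ^ 2 \<Rightarrow> bool" where
  "eigenfree T \<longleftrightarrow> (\<forall>v c. T *v v = c *s v \<longrightarrow> v = 0)"

lemma eigenfree_cross: "eigenfree T \<Longrightarrow> v \<noteq> 0 \<Longrightarrow> cross v (T *v v) \<noteq> 0"
  by (auto simp: cross_eq_0_iff eigenfree_def)

lemma invertible_iff_ker: "invertible A \<longleftrightarrow> (\<forall>v. A *v v = 0 \<longrightarrow> v = 0)"
  for A :: "'a::field ^ 2 ^ 2"
  using invertible_left_inverse matrix_left_invertible_ker by blast

text \<open>The values at \<open>v\<close> determine the values at \<open>T *v v\<close>, because \<open>A (T v) = e T (A v)\<close>. The
  factor \<open>e\<close> is there for the centralizer of an involution, whose matrices either commute
  (\<open>e = 1\<close>) or anticommute (\<open>e = -1\<close>) with \<open>T\<close>.\<close>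

lemma twisted_commutant_eqI:
  fixes A B T :: "'a::field ^ 2 ^ 2"
  assumes "eigenfree T" and "A ** T = mat e ** T ** A" and "B ** T = mat e ** T ** B"
    and "v \<noteq> 0" and "A *v v = B *v v"
  shows "A = B"
proof (rule matrix_eqI_basis)
  show "cross v (T *v v) \<noteq> 0" using assms by (simp add: eigenfree_cross)
  show "A *v (T *v v) = B *v (T *v v)"
    using assms by (metis matrix_vector_mul_assoc)
qed fact

lemma twisted_commutant_invertible:
  fixes A T :: "'a::field ^ 2 ^ 2"
  assumes "eigenfree T" and "A ** T = mat e ** T ** A"
  shows "invertible A \<longleftrightarrow> A \<noteq> 0"
proof
  assume "A \<noteq> 0"
  have "A = 0" if "A *v v = 0" "v \<noteq> 0" for v
    by (rule twisted_commutant_eqI[OF assms _ that(2)])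
      (simp_all add: that matrix_eq matrix_vector_mul_assoc[symmetric])
  with \<open>A \<noteq> 0\<close> show "invertible A" by (auto simp: invertible_iff_ker)
next
  show "invertible A \<Longrightarrow> A \<noteq> 0"
    by (metis invertible_iff_ker matrix_vector_mult_0 zero_neq_one axis_eq_0_iff)
qed

lemma linear_polynomial_commutes: "(mat a + mat b ** T) ** T = T ** (mat a + mat b ** T)"
  for T :: "'a::field ^ 2 ^ 2"
  by (simp add: matrix_eq matrix_vector_mul_assoc[symmetric] matrix_vector_mult_add_rdistrib
      mat_mult_vec vec.add vec.scale)

text \<open>On a nonzero vector \<open>v\<close> the value \<open>A *v v\<close> is a combination of the basis \<open>v\<close>, \<open>T *v v\<close>,
  and an element of the commutant is determined by its value on \<open>v\<close>. The commutant is
  therefore the field \<open>F[T]\<close>, quadratic over the base field \<open>F\<close>.\<close>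

lemma commutant_of_eigenfree:
  fixes A T :: "'a::field ^ 2 ^ 2"
  assumes "eigenfree T" and "A ** T = T ** A"
  obtains a b where "A = mat a + mat b ** T"
proof -
  have v: "axis 1 1 \<noteq> (0 :: 'a ^ 2)" by simp
  obtain a b where ab: "A *v axis 1 1 = a *s axis 1 1 + b *s (T *v axis 1 1)"
    using cramer2[OF eigenfree_cross[OF assms(1) v]] by blast
  have "A = mat a + mat b ** T"
  proof (rule twisted_commutant_eqI[OF assms(1) _ _ v])
    show "A ** T = mat 1 ** T ** A" using assms(2) by simp
    show "(mat a + mat b ** T) ** T = mat 1 ** T ** (mat a + mat b ** T)"
      by (simp add: linear_polynomial_commutes)
    show "A *v axis 1 1 = (mat a + mat b ** T) *v axis 1 1"
      by (simp add: ab matrix_vector_mult_add_rdistrib mat_mult_vec mat_mult_mat_vec)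
  qed
  then show thesis by (rule that)
qed

lemma commutant_commutes:
  fixes A B T :: "'a::field ^ 2 ^ 2"
  assumes "eigenfree T" and "A ** T = T ** A" and "B ** T = T ** B"
  shows "A ** B = B ** A"
proof -
  obtain a b where A: "A = mat a + mat b ** T" by (rule commutant_of_eigenfree[OF assms(1,2)])
  obtain c d where B: "B = mat c + mat d ** T" by (rule commutant_of_eigenfree[OF assms(1,3)])
  show ?thesis
    unfolding matrix_eq A B
    by (simp add: matrix_vector_mul_assoc[symmetric] matrix_vector_mult_add_rdistrib
        mat_mult_vec vec.add vec.scale vec.scale_right_distrib mult.commute add_ac)
qed

text \<open>In the field \<open>F[T]\<close> an element of the form \<open>mat d\<close> has at most two square roots, and they
  differ by sign. This plays the role of the uniqueness of the involution in a cyclic group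
  of even order.\<close>

lemma commuting_square_roots_of_scalar:
  fixes Y B T :: "'a::field ^ 2 ^ 2"
  assumes "eigenfree T" and "Y ** T = T ** Y" and "B ** T = T ** B"
    and "Y ** Y = mat d" and "B ** B = mat d"
  shows "Y = B \<or> Y = mat (-1) ** B"
proof (cases "Y - B = 0")
  case False
  have YB: "Y ** B = B ** Y" by (rule commutant_commutes[OF assms(1-3)])
  have "(Y - B) ** T = mat 1 ** T ** (Y - B)"
    using assms(2,3) by (simp add: matrix_eq matrix_vector_mul_assoc[symmetric]
        matrix_vector_mult_diff_rdistrib vec.diff)
  with False have "invertible (Y - B)"
    using twisted_commutant_invertible[OF assms(1)] by blast
  moreover have "(Y - B) *v (Y *v v + B *v v) = 0" for v
    using assms(4,5) YB by (simp add: matrix_eq matrix_vector_mul_assoc[symmetric]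
        matrix_vector_mult_diff_rdistrib vec.add)
  ultimately have "Y *v v + B *v v = 0" for v by (auto simp: invertible_iff_ker)
  then show ?thesis
    by (simp add: matrix_eq matrix_vector_mul_assoc[symmetric] mat_mult_vec eq_neg_iff_add_eq_0)
qed simp

section \<open>Projectivities and the projective line\<close>

text \<open>The projectivity induced by a matrix: its class modulo scalar matrices, written as the
  coset used in the definition of the quotient group.\<close>

abbreviation proj :: "'a::field ^ 2 ^ 2 \<Rightarrow> ('a ^ 2 ^ 2) set" where
  "proj A \<equiv> scalars2 #>\<^bsub>GL2\<^esub> A"

lemma mem_proj_iff: "B \<in> proj A \<longleftrightarrow> (\<exists>c. c \<noteq> 0 \<and> B = mat c ** A)"
  by (auto simp: r_coset_def GL2_def scalars2_def)

lemma carrier_GL2: "carrier GL2 = {A. invertible A}"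
  by (simp add: GL2_def)

lemma carrier_PGL2: "carrier PGL2 = proj ` {A. invertible A}"
  by (auto simp: PGL2_def FactGroup_def RCOSETS_def GL2_def)

lemma PGL2_cases:
  assumes "M \<in> carrier PGL2"
  obtains A where "invertible A" "M = proj A"
  using assms by (auto simp: carrier_PGL2)

lemma proj_in_PGL2: "invertible A \<Longrightarrow> proj A \<in> carrier PGL2"
  by (auto simp: carrier_PGL2)

lemma proj_mult:
  assumes "invertible A" and "invertible B"
  shows "proj A \<otimes>\<^bsub>PGL2\<^esub> proj B = proj (A ** B)"
  using normal.rcos_sum[OF normal_scalars2, of A B] assms
  by (simp add: PGL2_def GL2_def)

lemma proj_one: "\<one>\<^bsub>PGL2\<^esub> = proj (mat 1)"
proof -
  have "\<one>\<^bsub>PGL2\<^esub> = (scalars2 :: ('a ^ 2 ^ 2) set)" by (simp add: PGL2_def)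
  also have "\<dots> = proj (mat 1)"
    by (auto simp: r_coset_def scalars2_def GL2_def)
  finally show ?thesis .
qed

lemma proj_eq_iff:
  fixes A B :: "'a::field ^ 2 ^ 2"
  shows "proj A = proj B \<longleftrightarrow> (\<exists>c. c \<noteq> 0 \<and> A = mat c ** B)"
proof
  assume "proj A = proj B"
  moreover have "A \<in> proj A" unfolding mem_proj_iff by (intro exI[of _ 1]) simp
  ultimately show "\<exists>c. c \<noteq> 0 \<and> A = mat c ** B" by (simp add: mem_proj_iff)
next
  assume "\<exists>c. c \<noteq> 0 \<and> A = mat c ** B"
  then obtain c where c: "c \<noteq> 0" "A = mat c ** B" by blast
  have "mat d ** A = mat (d * c) ** B" "mat d ** B = mat (d / c) ** A" for d
    using c by (simp_all add: matrix_mul_assoc mat_mult_mat)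
  then show "proj A = proj B"
    using c(1) unfolding set_eq_iff mem_proj_iff by (metis divide_eq_0_iff mult_eq_0_iff)
qed

lemma proj_pow:
  fixes A :: "'a::field ^ 2 ^ 2" and k :: nat
  assumes "invertible A"
  shows "proj A [^]\<^bsub>PGL2\<^esub> k = proj (A [^]\<^bsub>GL2\<^esub> k)"
proof -
  interpret G: group "GL2 :: ('a ^ 2 ^ 2) monoid" by (rule group_GL2)
  interpret P: group "PGL2 :: ('a ^ 2 ^ 2) set monoid" by (rule group_PGL2)
  have "invertible (A [^]\<^bsub>GL2\<^esub> k)" for k :: nat
    using assms G.nat_pow_closed[of A k] by (simp add: carrier_GL2)
  then show ?thesis
    using assms by (induction k) (simp_all add: proj_one proj_mult, simp_all add: GL2_def)
qed

lemma span_singleton_eq_iff: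
  assumes "v \<noteq> 0" and "w \<noteq> (0 :: 'a::field ^ 2)"
  shows "vec.span {v} = vec.span {w} \<longleftrightarrow> cross v w = 0"
proof
  assume "vec.span {v} = vec.span {w}"
  then have "w \<in> vec.span {v}" by (simp add: vec.span_base)
  then show "cross v w = 0" using assms by (auto simp: vec.span_singleton cross_eq_0_iff)
next
  assume "cross v w = 0"
  then obtain c where "w = c *s v" using assms by (auto simp: cross_eq_0_iff)
  with assms have "w = c *s v" "v = (1 / c) *s w" by auto
  then have "w \<in> vec.span {v}" "v \<in> vec.span {w}" unfolding vec.span_singleton by blast+
  then show "vec.span {v} = vec.span {w}"
    by (intro subset_antisym vec.span_minimal) (auto simp: vec.subspace_span)
qed

lemma proj_line_eq: "proj_line = (\<lambda>v. vec.span {v}) ` {v :: 'a::field ^ 2. v \<noteq> 0}"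
proof (rule subset_antisym; rule subsetI)
  fix L :: "('a ^ 2) set"
  assume "L \<in> proj_line"
  then have L: "vec.subspace L" "vec.dim L = 1" by (auto simp: proj_line_def)
  obtain B where B: "B \<subseteq> L" "vec.independent B" "L \<subseteq> vec.span B" "card B = vec.dim L"
    using vec.basis_exists by blast
  then obtain v where "B = {v}" using L(2) card_1_singletonE by metis
  with B L(1) have "L = vec.span {v}" "v \<noteq> 0"
    using vec.span_minimal[of "{v}" L] by auto
  then show "L \<in> (\<lambda>v. vec.span {v}) ` {v. v \<noteq> 0}" by blast
next
  fix L :: "('a ^ 2) set"
  assume "L \<in> (\<lambda>v. vec.span {v}) ` {v. v \<noteq> 0}"
  then show "L \<in> proj_line"
    by (auto simp: proj_line_def vec.subspace_span vec.dim_span vec.dim_eq_card_independent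
        vec.independent_insert)
qed

lemma proj_line_cases:
  assumes "L \<in> proj_line"
  obtains v where "v \<noteq> 0" "L = vec.span {v}"
  using assms by (auto simp: proj_line_eq)

lemma span_in_proj_line: "v \<noteq> 0 \<Longrightarrow> vec.span {v} \<in> proj_line"
  by (auto simp: proj_line_eq)

lemma pgl_act_span: "pgl_act (proj A) (vec.span {v}) = vec.span {A *v v}"
  for A :: "'a::field ^ 2 ^ 2"
  by (simp add: pgl_act_rcoset vec.subspace_span)
    (auto simp: vec.span_singleton vec.scale image_image)

lemma invertible_mult_vec_nonzero:
  fixes A :: "'a::field ^ 2 ^ 2"
  shows "invertible A \<Longrightarrow> v \<noteq> 0 \<Longrightarrow> A *v v \<noteq> 0"
  by (auto simp: invertible_iff_ker)

lemma pgl_act_closed: "M \<in> carrier PGL2 \<Longrightarrow> L \<in> proj_line \<Longrightarrow> pgl_act M L \<in> proj_line"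
  by (elim PGL2_cases proj_line_cases)
    (simp add: pgl_act_span span_in_proj_line invertible_mult_vec_nonzero)

lemma pgl_act_mult:
  assumes "M \<in> carrier PGL2" and "N \<in> carrier PGL2" and "L \<in> proj_line"
  shows "pgl_act (M \<otimes>\<^bsub>PGL2\<^esub> N) L = pgl_act M (pgl_act N L)"
  using assms
  by (elim PGL2_cases proj_line_cases) (simp add: proj_mult pgl_act_span matrix_vector_mul_assoc)

lemma pgl_act_one: "L \<in> proj_line \<Longrightarrow> pgl_act \<one>\<^bsub>PGL2\<^esub> L = L"
  by (elim proj_line_cases) (simp add: proj_one pgl_act_span)

lemma pgl_act_inj:
  assumes "M \<in> carrier PGL2"
  shows "inj_on (pgl_act M) proj_line"
proof -
  interpret P: group "PGL2 :: ('a ^ 2 ^ 2) set monoid" by (rule group_PGL2)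
  have "pgl_act (inv\<^bsub>PGL2\<^esub> M) (pgl_act M L) = L" if "L \<in> proj_line" for L
    using assms that by (simp add: pgl_act_mult[symmetric] pgl_act_one)
  then show ?thesis by (rule inj_on_inverseI)
qed

text \<open>Choose vectors \<open>u\<close>, \<open>v\<close>, \<open>w\<close> on the three lines. The matrices of \<open>M\<close> and \<open>N\<close> agree on each of
  them up to a scalar. Since \<open>w\<close> is a combination of \<open>u\<close> and \<open>v\<close> with nonzero coefficients,
  comparing coefficients shows that the three scalars are equal.\<close>

lemma proj_eqI_three_points:
  fixes M N :: "('a::field ^ 2 ^ 2) set"
  assumes "M \<in> carrier PGL2" and "N \<in> carrier PGL2"
    and "L1 \<in> proj_line" "L2 \<in> proj_line" "L3 \<in> proj_line"
    and "L1 \<noteq> L2" "L1 \<noteq> L3" "L2 \<noteq> L3"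
    and "pgl_act M L1 = pgl_act N L1" "pgl_act M L2 = pgl_act N L2" "pgl_act M L3 = pgl_act N L3"
  shows "M = N"
proof -
  obtain A B where A: "invertible A" "M = proj A" and B: "invertible B" "N = proj B"
    using assms(1,2) by (metis PGL2_cases)
  obtain u v w where uvw: "u \<noteq> 0" "L1 = vec.span {u}" "v \<noteq> 0" "L2 = vec.span {v}"
      "w \<noteq> 0" "L3 = vec.span {w}"
    using assms(3-5) by (metis proj_line_cases)
  have proportional: "\<exists>c. A *v x = c *s (B *v x)"
    if "x \<noteq> 0" "pgl_act M (vec.span {x}) = pgl_act N (vec.span {x})" for x
  proof -
    have "A *v x \<in> vec.span {B *v x}"
      using that(2) by (metis A(2) B(2) pgl_act_span vec.span_base singletonI)
    then show ?thesis by (auto simp: vec.span_singleton)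
  qed
  obtain a b c where abc: "A *v u = a *s (B *v u)" "A *v v = b *s (B *v v)"
      "A *v w = c *s (B *v w)"
    using proportional uvw assms(9-11) by metis
  have uv: "cross u v \<noteq> 0" and uw: "cross u w \<noteq> 0" and vw: "cross v w \<noteq> 0"
    using uvw assms(6-8) by (simp_all add: span_singleton_eq_iff[symmetric])
  obtain s t where st: "w = s *s u + t *s v" using cramer2[OF uv] by blast
  have "s \<noteq> 0" "t \<noteq> 0"
    using uw vw st by (auto simp: cross_def)
  have "B *v ((s * (a - c)) *s u + (t * (b - c)) *s v) = 0"
    using abc(3) unfolding st
    by (simp add: vec.add vec.scale abc(1,2) algebra_simps vector_sadd_rdistrib vector_ssub_ldistrib)
  then have *: "(s * (a - c)) *s u + (t * (b - c)) *s v = 0"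
    using B(1) by (simp add: invertible_iff_ker)
  have "cross u ((s * (a - c)) *s u + (t * (b - c)) *s v) = t * (b - c) * cross u v"
    by (simp add: cross_def algebra_simps)
  with * uv \<open>t \<noteq> 0\<close> have bc: "b = c" by (simp add: cross_def)
  with * \<open>s \<noteq> 0\<close> uvw have ac: "a = c" by simp
  have "A = mat c ** B"
    using uv by (rule matrix_eqI_basis) (simp_all add: abc bc ac mat_mult_mat_vec)
  moreover have "c \<noteq> 0"
    using invertible_mult_vec_nonzero[OF A(1) uvw(1)] abc(1) ac by auto
  ultimately show ?thesis using A(2) B(2) proj_eq_iff by blast
qed

lemma card_agreement_le_2:
  fixes M N :: "('a::{field,finite} ^ 2 ^ 2) set"
  assumes "M \<in> carrier PGL2" and "N \<in> carrier PGL2" and "M \<noteq> N"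
  shows "card {L \<in> proj_line. pgl_act M L = pgl_act N L} \<le> 2"
proof (rule ccontr)
  assume "\<not> ?thesis"
  then have "3 \<le> card {L \<in> proj_line. pgl_act M L = pgl_act N L}" by simp
  then obtain K where K: "K \<subseteq> {L \<in> proj_line. pgl_act M L = pgl_act N L}" "card K = 3"
    by (rule obtain_subset_with_card_n) blast
  then obtain L1 L2 L3 where "K = {L1, L2, L3}" "L1 \<noteq> L2" "L1 \<noteq> L3" "L2 \<noteq> L3"
    by (auto simp: card_3_iff)
  with K proj_eqI_three_points[OF assms(1,2), of L1 L2 L3] assms(3) show False by auto
qed

text \<open>Every line is spanned by \<open>(1, t)\<close> for some \<open>t\<close>, or by \<open>(0, 1)\<close>. The upper bound is enough
  to turn a semiregular action of a group of order \<open>q + 1\<close> into a regular one.\<close>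

lemma card_proj_line_le: "card (proj_line :: ('a::{field,finite} ^ 2) set set) \<le> CARD('a) + 1"
proof -
  let ?p = "\<lambda>x :: 'a option. case x of None \<Rightarrow> vec.span {vector [0, 1 :: 'a]}
    | Some t \<Rightarrow> (vec.span {vector [1, t]} :: ('a ^ 2) set)"
  have "proj_line \<subseteq> range ?p"
  proof
    fix L :: "('a ^ 2) set"
    assume "L \<in> proj_line"
    then obtain v where v: "v \<noteq> 0" "L = vec.span {v}" by (rule proj_line_cases)
    have nz: "vector [0, 1 :: 'a] \<noteq> (0 :: 'a ^ 2)" "vector [1 :: 'a, t] \<noteq> (0 :: 'a ^ 2)" for t
      by (auto simp: vec_eq_iff forall_2 vector_2)
    show "L \<in> range ?p"
    proof (cases "v $ 1 = 0")
      case True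
      then have "L = ?p None"
        using v nz by (simp add: span_singleton_eq_iff) (simp add: cross_def vector_2)
      then show ?thesis by blast
    next
      case False
      then have "L = ?p (Some (v $ 2 / v $ 1))"
        using v nz by (simp add: span_singleton_eq_iff) (simp add: cross_def vector_2)
      then show ?thesis by blast
    qed
  qed
  then have "card (proj_line :: ('a ^ 2) set set) \<le> card (range ?p)" by (simp add: card_mono)
  also have "\<dots> \<le> card (UNIV :: 'a option set)" by (rule card_image_le) simp
  finally show ?thesis by (simp add: card_option)
qed

section \<open>Powers of matrices over a finite field\<close>

lemma finite_field_power_card_minus_1:
  fixes x :: "'a::{field,finite}"
  assumes "x \<noteq> 0"
  shows "x ^ (CARD('a) - 1) = 1"
proof -
  have "(\<Prod>y\<in>UNIV-{0}. x * y) = (\<Prod>y\<in>UNIV-{0}. y)"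
    by (rule prod.reindex_bij_witness[of _ "\<lambda>y. y / x" "\<lambda>y. x * y"]) (use assms in auto)
  then have "x ^ (CARD('a) - 1) * \<Prod>(UNIV - {0 :: 'a}) = \<Prod>(UNIV - {0 :: 'a})"
    by (simp add: prod.distrib)
  moreover have "\<Prod>(UNIV - {0 :: 'a}) \<noteq> 0" by simp
  ultimately show ?thesis by simp
qed

lemma of_nat_CARD_eq_0: "of_nat CARD('a) = (0 :: 'a::{field,finite})"
  using CHAR_dvd_CARD[where 'a = 'a] by (simp add: of_nat_eq_0_iff_char_dvd)

lemma GL2_mult: "A \<otimes>\<^bsub>GL2\<^esub> B = A ** B"
  by (simp add: GL2_def)

lemma GL2_one: "\<one>\<^bsub>GL2\<^esub> = mat 1"
  by (simp add: GL2_def)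

lemma GL2_pow_Suc: "A [^]\<^bsub>GL2\<^esub> (Suc k) = A [^]\<^bsub>GL2\<^esub> k ** A"
  by (simp add: GL2_mult)

lemma GL2_pow_invertible: "invertible A \<Longrightarrow> invertible (A [^]\<^bsub>GL2\<^esub> (k :: nat))"
  for A :: "'a::field ^ 2 ^ 2"
  using group.is_monoid[OF group_GL2] monoid.nat_pow_closed[of GL2 A k] by (simp add: carrier_GL2)

lemma GL2_pow_commute:
  fixes A :: "'a::field ^ 2 ^ 2" and i j :: nat
  assumes "invertible A"
  shows "A [^]\<^bsub>GL2\<^esub> i ** A [^]\<^bsub>GL2\<^esub> j = A [^]\<^bsub>GL2\<^esub> j ** A [^]\<^bsub>GL2\<^esub> i"
proof -
  interpret group "GL2 :: ('a ^ 2 ^ 2) monoid" by (rule group_GL2)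
  show ?thesis
    using assms nat_pow_comm[of A i j] by (simp add: carrier_GL2 GL2_mult)
qed

lemma triangular_pow:
  fixes S :: "'a::field ^ 2 ^ 2"
  assumes "S *v v = a *s v" and "S *v w = b *s v + d *s w"
  shows "(S [^]\<^bsub>GL2\<^esub> k) *v v = a ^ k *s v"
    and "\<exists>c. (S [^]\<^bsub>GL2\<^esub> k) *v w = c *s v + d ^ k *s w"
proof -
  have "(S [^]\<^bsub>GL2\<^esub> k) *v v = a ^ k *s v \<and> (\<exists>c. (S [^]\<^bsub>GL2\<^esub> k) *v w = c *s v + d ^ k *s w)"
  proof (induction k)
    case (Suc k)
    then obtain c where IH: "(S [^]\<^bsub>GL2\<^esub> k) *v v = a ^ k *s v"
        "(S [^]\<^bsub>GL2\<^esub> k) *v w = c *s v + d ^ k *s w" by blast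
    have "(S [^]\<^bsub>GL2\<^esub> Suc k) *v w = (b * a ^ k + d * c) *s v + d ^ Suc k *s w"
      unfolding GL2_pow_Suc matrix_vector_mul_assoc[symmetric]
      by (simp add: assms IH vec.add vec.scale vector_sadd_rdistrib vector_add_ldistrib add_ac)
    moreover have "(S [^]\<^bsub>GL2\<^esub> Suc k) *v v = a ^ Suc k *s v"
      unfolding GL2_pow_Suc matrix_vector_mul_assoc[symmetric]
      by (simp add: assms IH vec.scale)
    ultimately show ?case by blast
  qed (auto simp: GL2_one intro: exI[of _ 0])
  then show "(S [^]\<^bsub>GL2\<^esub> k) *v v = a ^ k *s v"
    "\<exists>c. (S [^]\<^bsub>GL2\<^esub> k) *v w = c *s v + d ^ k *s w" by auto
qed

lemma unipotent_pow:
  fixes U :: "'a::field ^ 2 ^ 2"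
  assumes "U *v v = v" and "U *v w = c *s v + w"
  shows "(U [^]\<^bsub>GL2\<^esub> m) *v w = (of_nat m * c) *s v + w"
proof (induction m)
  case (Suc m)
  have "(U [^]\<^bsub>GL2\<^esub> m) *v v = 1 ^ m *s v"
    by (rule triangular_pow(1)[of _ _ _ w c 1]) (simp_all add: assms)
  then show ?case
    unfolding GL2_pow_Suc matrix_vector_mul_assoc[symmetric]
    by (simp add: assms Suc vec.add vec.scale vector_sadd_rdistrib algebra_simps)
qed (simp add: GL2_one)

text \<open>A matrix with an eigenvector is triangular in a suitable basis. Its diagonal entries are
  nonzero elements of a field with \<open>q\<close> elements, so the power \<open>q - 1\<close> is unipotent, and the
  \<open>q\<close>-th power of a unipotent matrix is the identity since \<open>q = 0\<close> in the field.\<close>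

lemma pow_eq_one_if_eigenvector:
  fixes S :: "'a::{field,finite} ^ 2 ^ 2"
  assumes S: "invertible S" and "\<not> eigenfree S"
  shows "S [^]\<^bsub>GL2\<^esub> ((CARD('a) - 1) * CARD('a)) = mat 1"
proof -
  interpret group "GL2 :: ('a ^ 2 ^ 2) monoid" by (rule group_GL2)
  obtain v a where v: "v \<noteq> 0" "S *v v = a *s v"
    using assms(2) by (auto simp: eigenfree_def)
  obtain w where w: "cross v w \<noteq> 0"
  proof (cases "v $ 1 = 0")
    case True
    with v(1) have "cross v (axis 1 1) \<noteq> 0"
      by (auto simp: cross_def axis_def vec_eq_iff forall_2)
    then show thesis by (rule that)
  next
    case False
    then have "cross v (axis 2 1) \<noteq> 0" by (auto simp: cross_def axis_def)
    then show thesis by (rule that)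
  qed
  obtain b d where Sw: "S *v w = b *s v + d *s w" using cramer2[OF w] by blast
  have a: "a \<noteq> 0" using invertible_mult_vec_nonzero[OF S v(1)] v(2) by auto
  have d: "d \<noteq> 0"
  proof
    assume "d = 0"
    have "S *v (a *s w - b *s v) = 0"
      by (simp add: vec.diff vec.scale Sw v \<open>d = 0\<close> mult.commute)
    then have "a *s w - b *s v = 0" using S unfolding invertible_iff_ker by blast
    then have "cross v (a *s w) = cross v (b *s v)" by simp
    then show False using a w by (simp add: cross_def algebra_simps)
  qed
  define U where "U = S [^]\<^bsub>GL2\<^esub> (CARD('a) - 1)"
  have U1: "U *v v = v"
    using triangular_pow(1)[OF v(2) Sw, of "CARD('a) - 1"] finite_field_power_card_minus_1[OF a]
    by (simp add: U_def)
  obtain c where Uw: "U *v w = c *s v + w"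
    using triangular_pow(2)[OF v(2) Sw, of "CARD('a) - 1"] finite_field_power_card_minus_1[OF d]
    by (auto simp: U_def)
  have "U [^]\<^bsub>GL2\<^esub> CARD('a) = mat 1"
  proof (rule matrix_eqI_basis[OF w])
    show "(U [^]\<^bsub>GL2\<^esub> CARD('a)) *v v = mat 1 *v v"
      using triangular_pow(1)[of U v 1 w c 1 "CARD('a)"] U1 Uw by simp
    show "(U [^]\<^bsub>GL2\<^esub> CARD('a)) *v w = mat 1 *v w"
      by (simp add: unipotent_pow[OF U1 Uw] of_nat_CARD_eq_0)
  qed
  then show ?thesis
    using S by (simp add: U_def nat_pow_pow carrier_GL2)
qed

text \<open>If a power of \<open>S\<close> acts on a nonzero vector as a scalar \<open>c\<close>, then it agrees with \<open>mat c\<close>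
  everywhere, because both commute with the eigenfree matrix \<open>S\<close>.\<close>

lemma eigenfree_pow:
  fixes S :: "'a::field ^ 2 ^ 2" and k :: nat
  assumes "eigenfree S" and S: "invertible S" and "proj (S [^]\<^bsub>GL2\<^esub> k) \<noteq> \<one>\<^bsub>PGL2\<^esub>"
  shows "eigenfree (S [^]\<^bsub>GL2\<^esub> k)"
  unfolding eigenfree_def
proof (intro allI impI, rule ccontr)
  fix v c
  assume v: "(S [^]\<^bsub>GL2\<^esub> k) *v v = c *s v" "v \<noteq> 0"
  have "S [^]\<^bsub>GL2\<^esub> k ** S = S ** S [^]\<^bsub>GL2\<^esub> k"
    using GL2_pow_commute[OF S, of k 1] group.is_monoid[OF group_GL2] S
    by (simp add: GL2_one GL2_mult)
  then have "S [^]\<^bsub>GL2\<^esub> k = mat c"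
    using v by - (rule twisted_commutant_eqI[OF assms(1), where e = 1 and v = v],
      simp_all add: mat_mult_commute[of c S] mat_mult_vec)
  moreover from this have "c \<noteq> 0"
    using invertible_mult_vec_nonzero[OF GL2_pow_invertible[OF S] v(2), of k] v(1) by auto
  ultimately have "proj (S [^]\<^bsub>GL2\<^esub> k) = \<one>\<^bsub>PGL2\<^esub>"
    unfolding proj_one proj_eq_iff by (intro exI[of _ c]) simp
  with assms(3) show False ..
qed

section \<open>The orders of the projective group and of a centralizer\<close>

text \<open>The first row is any nonzero vector; the second is any vector outside the line that it
  spans.\<close>

lemma card_invertible:
  "card {A :: 'a::{field,finite} ^ 2 ^ 2. invertible A}
     = (CARD('a)\<^sup>2 - 1) * (CARD('a)\<^sup>2 - CARD('a))"
proof -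
  let ?m = "\<lambda>p. (\<chi> i. if i = 1 then fst p else snd p) :: 'a ^ 2 ^ 2"
  let ?D = "SIGMA v:{v :: 'a ^ 2. v \<noteq> 0}. {w. cross v w \<noteq> 0}"
  have inv: "invertible A \<longleftrightarrow> cross (A $ 1) (A $ 2) \<noteq> 0" for A :: "'a ^ 2 ^ 2"
    by (simp add: invertible_det_nz det_2 cross_def mult.commute)
  have "bij_betw ?m ?D {A. invertible A}"
    by (rule bij_betw_byWitness[where f' = "\<lambda>A. (A $ 1, A $ 2)"])
      (auto simp: inv vec_eq_iff forall_2 cross_def)
  then have "card {A :: 'a ^ 2 ^ 2. invertible A} = card ?D" by (simp add: bij_betw_same_card)
  also have "\<dots> = (\<Sum>v\<in>{v :: 'a ^ 2. v \<noteq> 0}. card {w. cross v w \<noteq> 0})" by simp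
  also have "\<dots> = (\<Sum>v\<in>{v :: 'a ^ 2. v \<noteq> 0}. CARD('a)\<^sup>2 - CARD('a))"
  proof (rule sum.cong)
    fix v :: "'a ^ 2"
    assume "v \<in> {v. v \<noteq> 0}"
    then have v: "v \<noteq> 0" by simp
    then have "{w. cross v w \<noteq> 0} = UNIV - range (\<lambda>c. c *s v)"
      by (auto simp: cross_eq_0_iff)
    moreover have "card (range (\<lambda>c. c *s v)) = CARD('a)"
      using v by (intro card_image injI) auto
    ultimately show "card {w. cross v w \<noteq> 0} = CARD('a)\<^sup>2 - CARD('a)"
      by (simp add: card_Diff_subset)
  qed simp
  also have "{v :: 'a ^ 2. v \<noteq> 0} = UNIV - {0}" by auto
  finally show ?thesis by (simp add: card_Diff_subset)
qed

text \<open>Evaluation at a fixed nonzero vector identifies the commutant with the plane.\<close>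

lemma card_commutant:
  fixes T :: "'a::{field,finite} ^ 2 ^ 2"
  assumes "eigenfree T"
  shows "card {A. A \<noteq> 0 \<and> A ** T = T ** A} = CARD('a)\<^sup>2 - 1"
proof -
  have v: "axis 1 1 \<noteq> (0 :: 'a ^ 2)" by simp
  have "bij_betw (\<lambda>A. A *v axis 1 1) {A. A ** T = T ** A} UNIV"
    unfolding bij_betw_def
  proof
    show "inj_on (\<lambda>A. A *v axis 1 1) {A. A ** T = T ** A}"
      by (rule inj_onI, rule twisted_commutant_eqI[OF assms, of _ 1 _ "axis 1 1"]) simp_all
    have "\<exists>A. A ** T = T ** A \<and> w = A *v axis 1 1" for w
    proof -
      obtain a b where ab: "w = a *s axis 1 1 + b *s (T *v axis 1 1)"
        using cramer2[OF eigenfree_cross[OF assms v]] by blast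
      have "(mat a + mat b ** T) ** T = T ** (mat a + mat b ** T)"
        by (rule linear_polynomial_commutes)
      moreover have "w = (mat a + mat b ** T) *v axis 1 1"
        by (simp add: ab matrix_vector_mult_add_rdistrib mat_mult_vec mat_mult_mat_vec)
      ultimately show ?thesis by blast
    qed
    then show "(\<lambda>A. A *v axis 1 1) ` {A. A ** T = T ** A} = UNIV" by blast
  qed
  then have "card {A. A ** T = T ** A} = CARD('a)\<^sup>2" by (simp add: bij_betw_same_card)
  moreover have "{A. A \<noteq> 0 \<and> A ** T = T ** A} = {A. A ** T = T ** A} - {0}" by auto
  moreover have "0 ** T = T ** 0" by (simp add: matrix_eq matrix_vector_mul_assoc[symmetric])
  ultimately show ?thesis by (simp add: card_Diff_subset)
qed

text \<open>\<open>B\<close> has no eigenvector, so its entry below the diagonal is nonzero, and then the fact that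
  the square of \<open>B\<close> is scalar forces its trace to vanish. For matrices with trace zero,
  anticommuting with \<open>B\<close> means that the trace of the product is zero; the matrix \<open>K\<close> in the
  proof is an upper triangular solution of this linear equation.\<close>

lemma anticommuting_matrix:
  fixes B :: "'a::field ^ 2 ^ 2"
  assumes "eigenfree B" and "B ** B = mat d"
  obtains K e where "K ** B = mat (-1) ** B ** K" and "e \<noteq> 0" and "K ** K = mat e"
proof -
  let ?x = "B $ 1 $ 1" and ?z = "B $ 2 $ 1"
  have z: "?z \<noteq> 0"
  proof -
    have "axis 1 1 \<noteq> (0 :: 'a ^ 2)" by simp
    from eigenfree_cross[OF assms(1) this] show ?thesis
      by (simp add: cross_def axis_def matrix_vector_mult_def sum_2)
  qed
  have "(B ** B) $ 2 $ 1 = 0" using assms(2) by (simp add: mat_def)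
  then have "?z * (?x + B $ 2 $ 2) = 0" by (simp add: matrix_matrix_mult_def sum_2 algebra_simps)
  with z have tr: "B $ 2 $ 2 = - ?x" by (simp add: eq_neg_iff_add_eq_0 add.commute)
  \<comment> \<open>with \<open>B = (x, y; z, -x)\<close> and \<open>K = (a, b; 0, -a)\<close> the equation is \<open>2 a x + b z = 0\<close>\<close>
  define K :: "'a ^ 2 ^ 2" where "K = vector [vector [?z, - 2 * ?x], vector [0, - ?z]]"
  have K: "K $ 1 $ 1 = ?z" "K $ 1 $ 2 = - 2 * ?x" "K $ 2 $ 1 = 0" "K $ 2 $ 2 = - ?z"
    by (simp_all add: K_def vector_2)
  have "K ** B = mat (-1) ** B ** K"
    by (simp add: vec_eq_iff forall_2 matrix_matrix_mult_def sum_2 mat_def K tr algebra_simps)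
  moreover have "K ** K = mat (?z * ?z)"
    by (simp add: vec_eq_iff forall_2 matrix_matrix_mult_def sum_2 mat_def K)
  ultimately show thesis using z by (intro that[of K "?z * ?z"]) auto
qed

lemma matrix_zero_mult: "0 ** A = 0" "A ** 0 = 0" for A :: "'a::field ^ 2 ^ 2"
  by (simp_all add: matrix_eq matrix_vector_mul_assoc[symmetric])

text \<open>Multiplication by one invertible anticommuting matrix interchanges commuting and
  anticommuting matrices.\<close>

lemma card_anticommutant:
  fixes B :: "'a::{field,finite} ^ 2 ^ 2"
  assumes "eigenfree B" and "B ** B = mat d"
  shows "card {A. A \<noteq> 0 \<and> A ** B = mat (-1) ** B ** A} = CARD('a)\<^sup>2 - 1"
proof -
  obtain K e where K: "K ** B = mat (-1) ** B ** K" "e \<noteq> 0" "K ** K = mat e"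
    using anticommuting_matrix[OF assms] by blast
  have KB: "K *v (B *v x) = - (B *v (K *v x))" for x
    using K(1) by (simp add: matrix_eq matrix_vector_mul_assoc[symmetric] mat_mult_vec)
  have KK: "K *v (K *v x) = e *s x" for x
    using K(3) by (simp add: matrix_eq matrix_vector_mul_assoc[symmetric] mat_mult_vec)
  have KK': "A ** K ** K = mat e ** A" for A
    by (simp add: matrix_eq matrix_vector_mul_assoc[symmetric] mat_mult_vec KK vec.scale)
  have "bij_betw (\<lambda>A. A ** K) {A. A \<noteq> 0 \<and> A ** B = B ** A}
      {A. A \<noteq> 0 \<and> A ** B = mat (-1) ** B ** A}"
  proof (rule bij_betw_byWitness[where f' = "\<lambda>A. mat (1 / e) ** (A ** K)"])
    show "\<forall>A\<in>{A. A \<noteq> 0 \<and> A ** B = B ** A}. mat (1 / e) ** (A ** K ** K) = A"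
      by (simp add: KK' matrix_mul_assoc mat_mult_mat K(2))
    show "\<forall>A\<in>{A. A \<noteq> 0 \<and> A ** B = mat (-1) ** B ** A}. mat (1 / e) ** (A ** K) ** K = A"
      using K(2) by (simp add: matrix_eq matrix_vector_mul_assoc[symmetric] mat_mult_vec KK vec.scale)
    have nz: "A ** K \<noteq> 0" "mat (1 / e) ** (A ** K) \<noteq> 0" if "A \<noteq> 0" for A
    proof -
      have "A = mat (1 / e) ** (A ** K) ** K" "A = mat (1 / e) ** ((A ** K) ** K)"
        using K(2) by (simp_all add: matrix_eq matrix_vector_mul_assoc[symmetric] mat_mult_vec KK vec.scale)
      with that show "A ** K \<noteq> 0" "mat (1 / e) ** (A ** K) \<noteq> 0"
        by (auto simp: matrix_zero_mult)
    qed
    have anti: "A ** K ** B = mat (-1) ** B ** (A ** K)" if "A ** B = B ** A" for A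
      using that by (simp add: matrix_eq matrix_vector_mul_assoc[symmetric] mat_mult_vec KB vec.neg)
    show "(\<lambda>A. A ** K) ` {A. A \<noteq> 0 \<and> A ** B = B ** A}
        \<subseteq> {A. A \<noteq> 0 \<and> A ** B = mat (-1) ** B ** A}"
      by (intro image_subsetI CollectI conjI nz(1) anti) simp_all
    have comm: "mat (1 / e) ** (A ** K) ** B = B ** (mat (1 / e) ** (A ** K))"
      if "A ** B = mat (-1) ** B ** A" for A
      using that by (simp add: matrix_eq matrix_vector_mul_assoc[symmetric] mat_mult_vec KB
          vec.neg vec.scale)
    show "(\<lambda>A. mat (1 / e) ** (A ** K)) ` {A. A \<noteq> 0 \<and> A ** B = mat (-1) ** B ** A}
        \<subseteq> {A. A \<noteq> 0 \<and> A ** B = B ** A}"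
      by (intro image_subsetI CollectI conjI nz(2) comm) simp_all
  qed
  then show ?thesis using card_commutant[OF assms(1)] by (simp add: bij_betw_same_card)
qed

text \<open>Each projectivity is represented by \<open>q - 1\<close> matrices, so projectivities can be counted by
  their matrices.\<close>

lemma card_proj_fibres:
  fixes Y :: "('a::{field,finite} ^ 2 ^ 2) set set"
  assumes "Y \<subseteq> carrier PGL2"
  shows "(CARD('a) - 1) * card Y = card {A. invertible A \<and> proj A \<in> Y}"
proof -
  have inv: "invertible B" "proj B = proj A" if A: "invertible A" and BA: "B \<in> proj A" for A B :: "'a ^ 2 ^ 2"
  proof -
    obtain c where c: "c \<noteq> 0" "B = mat c ** A" using BA by (auto simp: mem_proj_iff)
    then show "invertible B" using A by (simp add: invertible_mult invertible_mat)
    show "proj B = proj A" using c by (auto simp: proj_eq_iff)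
  qed
  have self: "A \<in> proj A" for A :: "'a ^ 2 ^ 2"
    unfolding mem_proj_iff by (intro exI[of _ 1]) simp
  have "\<Union>Y = {A. invertible A \<and> proj A \<in> Y}"
  proof (rule subset_antisym; rule subsetI)
    fix B
    assume "B \<in> \<Union>Y"
    then obtain M where M: "M \<in> Y" "B \<in> M" by blast
    then obtain A where A: "invertible A" "M = proj A" using assms by (meson PGL2_cases subsetD)
    show "B \<in> {A. invertible A \<and> proj A \<in> Y}"
      using inv[OF A(1), of B] M A(2) by simp
  qed (use self in blast)
  moreover have "(CARD('a) - 1) * card Y = card (\<Union>Y)"
  proof (rule card_partition)
    fix M
    assume "M \<in> Y"
    then obtain A where A: "invertible A" "M = proj A" using assms by (meson PGL2_cases subsetD)
    have "proj A = (\<lambda>c. mat c ** A) ` (UNIV - {0})" by (auto simp: mem_proj_iff)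
    moreover have "inj (\<lambda>c. mat c ** A)"
    proof (rule injI)
      fix c d
      assume "mat c ** A = mat d ** A"
      then have "(mat c ** A) *v axis 1 1 = (mat d ** A) *v axis 1 1" by simp
      then have "c *s (A *v axis 1 1) = d *s (A *v axis 1 1)" by (simp only: mat_mult_mat_vec)
      moreover have "A *v axis 1 1 \<noteq> 0" by (rule invertible_mult_vec_nonzero[OF A(1)]) simp
      ultimately show "c = d" by simp
    qed
    ultimately show "card M = CARD('a) - 1"
      by (simp add: A(2) card_image inj_on_subset card_Diff_subset)
  next
    fix M N
    assume MN: "M \<in> Y" "N \<in> Y" "M \<noteq> N"
    obtain A B where AB: "invertible A" "M = proj A" "invertible B" "N = proj B"
      using assms MN by (meson PGL2_cases subsetD)
    have "proj A = proj B" if "D \<in> M" "D \<in> N" for D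
      using inv(2)[OF AB(1), of D] inv(2)[OF AB(3), of D] that AB(2,4) by simp
    with MN(3) AB(2,4) show "M \<inter> N = {}" by auto
  qed simp_all
  ultimately show ?thesis by simp
qed

lemma card_PGL2: "card (carrier (PGL2 :: ('a::{field,finite} ^ 2 ^ 2) set monoid))
    = CARD('a) * (CARD('a)\<^sup>2 - 1)"
proof -
  let ?P = "carrier (PGL2 :: ('a ^ 2 ^ 2) set monoid)"
  have q: "CARD('a) > 1"
    using card_mono[of UNIV "{0, 1 :: 'a}"] by simp
  have "{A :: 'a ^ 2 ^ 2. invertible A \<and> proj A \<in> ?P} = {A. invertible A}"
    by (auto simp: proj_in_PGL2)
  then have "(CARD('a) - 1) * card ?P = (CARD('a)\<^sup>2 - 1) * (CARD('a)\<^sup>2 - CARD('a))"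
    using card_proj_fibres[of ?P] by (simp add: card_invertible)
  also have "\<dots> = (CARD('a) - 1) * (CARD('a) * (CARD('a)\<^sup>2 - 1))"
    by (simp add: power2_eq_square algebra_simps)
  finally show ?thesis using q by simp
qed

lemma two_neq_0_if_odd_card:
  assumes "odd CARD('a)"
  shows "(2 :: 'a::{field,finite}) \<noteq> 0"
proof
  assume 2: "(2 :: 'a) = 0"
  obtain k where "CARD('a) = 2 * k + 1" using assms by (rule oddE)
  then have "of_nat CARD('a) = (2 * of_nat k + 1 :: 'a)" by simp
  with 2 show False by (simp add: of_nat_CARD_eq_0)
qed

text \<open>If the projectivity of \<open>A\<close> commutes with that of \<open>B\<close>, then \<open>A ** B\<close> and \<open>B ** A\<close> differ by
  a scalar \<open>c\<close>; comparing determinants gives \<open>c\<^sup>2 = 1\<close>. The two signs contribute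
  \<open>q\<^sup>2 - 1\<close> matrices each, and they exclude each other because \<open>q\<close> is odd.\<close>

lemma card_centralizer:
  fixes B :: "'a::{field,finite} ^ 2 ^ 2"
  assumes "odd CARD('a)" and B: "invertible B" "eigenfree B" "B ** B = mat d"
  shows "card {M \<in> carrier PGL2. M \<otimes>\<^bsub>PGL2\<^esub> proj B = proj B \<otimes>\<^bsub>PGL2\<^esub> M} = 2 * (CARD('a) + 1)"
proof -
  let ?Y = "{M \<in> carrier PGL2. M \<otimes>\<^bsub>PGL2\<^esub> proj B = proj B \<otimes>\<^bsub>PGL2\<^esub> M}"
  let ?C = "{A. A \<noteq> 0 \<and> A ** B = B ** A}" and ?A = "{A. A \<noteq> 0 \<and> A ** B = mat (-1) ** B ** A}"
  have q: "CARD('a) > 1"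
    using card_mono[of UNIV "{0, 1 :: 'a}"] by simp
  have "{A. invertible A \<and> proj A \<in> ?Y} = ?C \<union> ?A"
  proof (rule subset_antisym; rule subsetI)
    fix A
    assume "A \<in> {A. invertible A \<and> proj A \<in> ?Y}"
    then have A: "invertible A" and "proj (A ** B) = proj (B ** A)"
      using B(1) by (auto simp: proj_mult)
    then obtain c where c: "c \<noteq> 0" "A ** B = mat c ** (B ** A)" by (auto simp: proj_eq_iff)
    have "det A * det B = det (mat c :: 'a ^ 2 ^ 2) * (det B * det A)"
      by (simp only: c(2) det_mul[symmetric])
    moreover have "det (mat c :: 'a ^ 2 ^ 2) = c * c" by (simp add: det_2 mat_def)
    moreover have "det A \<noteq> 0" "det B \<noteq> 0" using A B(1) by (simp_all add: invertible_det_nz)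
    ultimately have "c * c = 1" by simp
    then have "c = 1 \<or> c = -1" by (simp add: square_eq_1_iff)
    moreover have "A \<noteq> 0" using invertible_mult_vec_nonzero[OF A, of "axis 1 1"] by auto
    ultimately show "A \<in> ?C \<union> ?A" using c(2) by (auto simp: matrix_mul_assoc)
  next
    fix A
    assume A: "A \<in> ?C \<union> ?A"
    then have "A \<noteq> 0" and "A ** B = mat 1 ** B ** A \<or> A ** B = mat (-1) ** B ** A" by auto
    then obtain c where c: "c \<noteq> 0" "A ** B = mat c ** B ** A" "A \<noteq> 0"
      by (metis neg_equal_0_iff_equal zero_neq_one)
    then have "invertible A" using twisted_commutant_invertible[OF B(2)] by blast
    moreover have "proj (A ** B) = proj (B ** A)"
      unfolding proj_eq_iff using c by (auto simp: matrix_mul_assoc)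
    ultimately show "A \<in> {A. invertible A \<and> proj A \<in> ?Y}"
      using B(1) by (simp add: proj_mult proj_in_PGL2)
  qed
  moreover have "?C \<inter> ?A = {}"
  proof -
    have False if A: "A \<noteq> 0" "A ** B = B ** A" "A ** B = mat (-1) ** B ** A" for A
    proof -
      have "invertible (A ** B)"
        using twisted_commutant_invertible[OF B(2) A(3)] A(1) B(1) by (simp add: invertible_mult)
      moreover have "2 *s ((A ** B) *v x) = 0" for x
      proof -
        have "(A ** B) *v x = - ((A ** B) *v x)"
          by (subst A(3), simp only: A(2) matrix_mul_assoc[symmetric] mat_mult_mat_vec) simp
        then have "(A ** B) *v x + (A ** B) *v x = 0" by (simp add: eq_neg_iff_add_eq_0)
        then show ?thesis by (simp add: vec_eq_iff)
      qed
      ultimately show False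
        using two_neq_0_if_odd_card[OF assms(1)] invertible_mult_vec_nonzero[of "A ** B" "axis 1 1"]
        by auto
    qed
    then show ?thesis by blast
  qed
  ultimately have "(CARD('a) - 1) * card ?Y = 2 * (CARD('a)\<^sup>2 - 1)"
    using card_proj_fibres[of ?Y] card_commutant[OF B(2)] card_anticommutant[OF B(2,3)]
    by (simp add: card_Un_disjoint)
  also have "\<dots> = (CARD('a) - 1) * (2 * (CARD('a) + 1))"
    by (cases "CARD('a)") (simp_all add: power2_eq_square)
  finally show ?thesis using q unfolding mult_cancel1 by simp
qed

section \<open>APN permutations of residues\<close>

lemma (in residues) res_minus_eq: "x \<ominus> y = (x - y) mod m"
  by (simp add: a_minus_def res_add_eq res_neg_eq mod_add_right_eq)

lemma carrier_residue_ring: "carrier (residue_ring m) = {0..m - 1}"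
  by (simp add: residue_ring_def)

text \<open>Every permutation attains the value \<open>2\<close>. For the shift \<open>u = 1\<close> the difference
  function maps \<open>n\<close> residues to the \<open>n - 1\<close> nonzero residues, so some difference occurs at
  least twice.\<close>

lemma is_APN_permutationI:
  fixes F :: "int \<Rightarrow> int"
  assumes n: "n > 1" and bij: "bij_betw F {0..int n - 1} {0..int n - 1}"
    and le: "\<And>u v. u \<in> {0..int n - 1} \<Longrightarrow> u \<noteq> 0 \<Longrightarrow> v \<in> {0..int n - 1} \<Longrightarrow>
        card {x \<in> {0..int n - 1}. (F ((x + u) mod int n) - F x) mod int n = v} \<le> 2"
  shows "is_APN n F"
proof -
  let ?Z = "{0..int n - 1}"
  let ?N = "\<lambda>u v. card {x \<in> ?Z. (F ((x + u) mod int n) - F x) mod int n = v}"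
  let ?S = "{?N u v | u v. u \<in> ?Z \<and> u \<noteq> 0 \<and> v \<in> ?Z}"
  define g where "g x = (F ((x + 1) mod int n) - F x) mod int n" for x
  have "g ` ?Z \<subseteq> ?Z - {0}"
  proof
    fix y
    assume "y \<in> g ` ?Z"
    then obtain x where x: "x \<in> ?Z" "y = g x" by blast
    have "g x \<noteq> 0"
    proof
      assume "g x = 0"
      have x1: "(x + 1) mod int n \<in> ?Z" using n by simp
      then have "F ((x + 1) mod int n) \<in> ?Z" "F x \<in> ?Z"
        using bij_betwE[OF bij] x(1) by blast+
      moreover have "int n dvd F ((x + 1) mod int n) - F x"
        using \<open>g x = 0\<close> by (simp add: g_def mod_eq_0_iff_dvd)
      ultimately have "F ((x + 1) mod int n) mod int n = F x mod int n"
        by (simp only: mod_eq_dvd_iff)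
      with \<open>F ((x + 1) mod int n) \<in> ?Z\<close> \<open>F x \<in> ?Z\<close> have "F ((x + 1) mod int n) = F x"
        by (simp add: mod_pos_pos_trivial)
      then have "(x + 1) mod int n = x"
        using bij x(1) x1 by (auto simp: bij_betw_def dest: inj_onD)
      then have "(x + 1) mod int n = x mod int n" using x(1) by simp
      then have "int n dvd 1" by (simp add: mod_eq_dvd_iff)
      with n show False by simp
    qed
    with x(2) show "y \<in> ?Z - {0}" using n by (simp add: g_def)
  qed
  then have "card (g ` ?Z) \<le> card (?Z - {0})" by (intro card_mono) auto
  also have "\<dots> < card ?Z" using n by (intro card_Diff1_less) simp_all
  finally have "\<not> inj_on g ?Z" by (rule pigeonhole)
  then obtain x y where xy: "x \<in> ?Z" "y \<in> ?Z" "x \<noteq> y" "g x = g y" unfolding inj_on_def by blast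
  have "card {x, y} \<le> ?N 1 (g x)"
  proof (rule card_mono)
    show "{x, y} \<subseteq> {z \<in> ?Z. (F ((z + 1) mod int n) - F z) mod int n = g x}"
      using xy unfolding g_def[symmetric] by simp
  qed (rule finite_subset[OF Collect_restrict], simp)
  moreover have 1: "1 \<in> ?Z" "g x \<in> ?Z" using n by (auto simp: g_def)
  ultimately have "?N 1 (g x) = 2" using le[OF 1(1) _ 1(2)] xy(3) by simp
  then have "2 \<in> ?S" using 1 by (intro CollectI exI[of _ 1] exI[of _ "g x"]) simp
  moreover have "s \<le> 2" if "s \<in> ?S" for s using that le by blast
  moreover from this have "finite ?S" by (meson finite_nat_set_iff_bounded_le)
  ultimately have "Max ?S = 2" by (intro Max_eqI) auto
  moreover have "residues (int n)" using n by unfold_locales simp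
  ultimately show ?thesis
    unfolding is_APN_def diff_uniformity_def Let_def
    by (simp add: residues.res_minus_eq residues.res_add_eq residues.res_zero_eq
        carrier_residue_ring)
qed

section \<open>Singer cycles\<close>

locale singer_cycle =
  fixes R :: "('a::{field,finite} ^ 2 ^ 2) set" and P0 :: "('a ^ 2) set"
  assumes R_carrier: "R \<in> carrier PGL2"
    and ord_R: "group.ord PGL2 R = CARD('a) + 1"
    and odd_card: "odd CARD('a)"
    and P0: "P0 \<in> proj_line"
begin

sublocale PGL: group "PGL2 :: ('a ^ 2 ^ 2) set monoid"
  by (rule group_PGL2)

lemma card_field_ge_3: "CARD('a) \<ge> 3"
proof -
  have "CARD('a) > 1"
    using card_mono[of UNIV "{0, 1 :: 'a}"] by simp
  with odd_card show ?thesis by (cases "CARD('a) = 2") auto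
qed

lemma R_int_pow_eq_iff: "R [^]\<^bsub>PGL2\<^esub> i = R [^]\<^bsub>PGL2\<^esub> j \<longleftrightarrow> i mod (int CARD('a) + 1) = j mod (int CARD('a) + 1)"
  for i j :: int
  by (simp add: PGL.int_pow_eq R_carrier ord_R mod_eq_dvd_iff dvd_diff_commute[of _ i] add.commute)

lemma R_pow_eq_one_iff: "R [^]\<^bsub>PGL2\<^esub> k = \<one>\<^bsub>PGL2\<^esub> \<longleftrightarrow> CARD('a) + 1 dvd k" for k :: nat
  using PGL.pow_eq_id[OF R_carrier, of k] ord_R by simp

text \<open>If there were an eigenvector, the order \<open>q + 1\<close> of \<open>R\<close> would divide \<open>(q - 1) q\<close>, which leaves the remainder \<open>2\<close>
  modulo \<open>q + 1\<close>, and \<open>q + 1 \<ge> 4\<close>.\<close>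

lemma singer_matrix:
  obtains S where "invertible S" and "R = proj S" and "eigenfree S"
proof -
  obtain S where S: "invertible S" "R = proj S" using R_carrier by (rule PGL2_cases)
  have "eigenfree S"
  proof (rule ccontr)
    assume "\<not> eigenfree S"
    then have "R [^]\<^bsub>PGL2\<^esub> ((CARD('a) - 1) * CARD('a)) = \<one>\<^bsub>PGL2\<^esub>"
      by (simp only: S(2) proj_pow[OF S(1)] pow_eq_one_if_eigenvector[OF S(1)] proj_one not_False_eq_True)
    then have dvd: "CARD('a) + 1 dvd (CARD('a) - 1) * CARD('a)" by (simp only: R_pow_eq_one_iff)
    obtain m where m: "CARD('a) = m + 3"
      using card_field_ge_3 by (metis add.commute le_iff_add)
    then have "CARD('a) + 1 = m + 4" "CARD('a) - 1 = m + 2" by simp_all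
    with dvd m have "m + 4 dvd (m + 2) * (m + 3)" by metis
    moreover have "(m + 2) * (m + 3) = (m + 4) * (m + 1) + 2" by (simp add: algebra_simps)
    ultimately have "m + 4 dvd 2" by (metis dvd_add_right_iff dvd_triv_left)
    then show False by (auto dest: dvd_imp_le)
  qed
  with S show thesis by (rule that)
qed

lemma R_pow_fixed_point:
  fixes k :: nat
  assumes L: "L \<in> proj_line" and fixed: "pgl_act (R [^]\<^bsub>PGL2\<^esub> k) L = L"
  shows "R [^]\<^bsub>PGL2\<^esub> k = \<one>\<^bsub>PGL2\<^esub>"
proof (rule ccontr)
  assume ne: "R [^]\<^bsub>PGL2\<^esub> k \<noteq> \<one>\<^bsub>PGL2\<^esub>"
  obtain S where S: "invertible S" "R = proj S" "eigenfree S" by (rule singer_matrix)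
  let ?T = "S [^]\<^bsub>GL2\<^esub> k"
  have Rk: "R [^]\<^bsub>PGL2\<^esub> k = proj ?T" by (simp add: S proj_pow)
  with ne have "eigenfree ?T" using eigenfree_pow[OF S(3,1)] by simp
  moreover obtain v where v: "v \<noteq> 0" "L = vec.span {v}" using L by (rule proj_line_cases)
  have "?T *v v \<in> vec.span {v}"
    using fixed unfolding Rk v(2) pgl_act_span by (metis vec.span_base singletonI)
  then obtain c where "?T *v v = c *s v" by (auto simp: vec.span_singleton)
  ultimately show False using v(1) by (auto simp: eigenfree_def)
qed

lemma proj_exp_mod: "proj_exp R P0 (i mod (int CARD('a) + 1)) = proj_exp R P0 i"
proof -
  have "R [^]\<^bsub>PGL2\<^esub> (i mod (int CARD('a) + 1)) = R [^]\<^bsub>PGL2\<^esub> i"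
    unfolding R_int_pow_eq_iff by simp
  then show ?thesis by (simp add: proj_exp_def)
qed

lemma proj_exp_add: "proj_exp R P0 (i + j) = pgl_act (R [^]\<^bsub>PGL2\<^esub> i) (proj_exp R P0 j)"
  unfolding proj_exp_def
  by (simp add: PGL.int_pow_mult R_carrier pgl_act_mult P0)

lemma proj_exp_in_line: "proj_exp R P0 i \<in> proj_line"
  by (simp add: proj_exp_def pgl_act_closed R_carrier P0)

text \<open>Nontrivial powers of \<open>R\<close> have no fixed points, and there are at least as many powers as points.\<close>

lemma bij_proj_exp: "bij_betw (proj_exp R P0) {0..int CARD('a)} proj_line"
proof -
  have inj: "inj_on (proj_exp R P0) {0..int CARD('a)}"
  proof (rule linorder_inj_onI)
    fix i j
    assume ij: "i < j" "i \<in> {0..int CARD('a)}" "j \<in> {0..int CARD('a)}"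
    show "proj_exp R P0 i \<noteq> proj_exp R P0 j"
    proof
      assume "proj_exp R P0 i = proj_exp R P0 j"
      then have "pgl_act (R [^]\<^bsub>PGL2\<^esub> nat (j - i)) (proj_exp R P0 i) = proj_exp R P0 i"
        using proj_exp_add[of "int (nat (j - i))" i] ij(1) by (simp add: int_pow_int)
      then have "R [^]\<^bsub>PGL2\<^esub> nat (j - i) = \<one>\<^bsub>PGL2\<^esub>"
        by (rule R_pow_fixed_point[OF proj_exp_in_line])
      then have "CARD('a) + 1 dvd nat (j - i)" by (simp add: R_pow_eq_one_iff)
      then have "CARD('a) + 1 \<le> nat (j - i)" using ij(1) by (intro dvd_imp_le) auto
      with ij show False by auto
    qed
  qed auto
  have "proj_exp R P0 ` {0..int CARD('a)} = proj_line"
  proof (rule card_seteq)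
    show "card (proj_line :: ('a ^ 2) set set) \<le> card (proj_exp R P0 ` {0..int CARD('a)})"
      using card_proj_line_le[where 'a = 'a] by (simp add: card_image[OF inj])
  qed (auto simp: proj_exp_in_line)
  with inj show ?thesis by (simp add: bij_betw_def)
qed

lemma carrier_residues: "carrier (residue_ring (int (CARD('a) + 1))) = {0..int CARD('a)}"
  by (simp add: carrier_residue_ring)

lemma bij_pgl_act:
  fixes M :: "('a ^ 2 ^ 2) set"
  assumes M: "M \<in> carrier PGL2"
  shows "bij_betw (pgl_act M) proj_line proj_line"
proof -
  have "pgl_act M ` proj_line = proj_line"
    by (rule endo_inj_surj) (use M in \<open>auto simp: pgl_act_closed pgl_act_inj\<close>)
  with M show ?thesis by (simp add: bij_betw_def pgl_act_inj)
qed

lemma bij_proj_perm: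
  assumes "M \<in> carrier PGL2"
  shows "bij_betw (proj_perm R P0 M) {0..int CARD('a)} {0..int CARD('a)}"
proof -
  have "bij_betw (proj_log R P0) proj_line {0..int CARD('a)}"
    unfolding proj_log_def carrier_residues by (rule bij_betw_inv_into[OF bij_proj_exp])
  then have "bij_betw (proj_log R P0 \<circ> pgl_act M \<circ> proj_exp R P0) {0..int CARD('a)} {0..int CARD('a)}"
    using bij_pgl_act[OF assms] bij_proj_exp by (blast intro: bij_betw_trans)
  then show ?thesis
    unfolding proj_perm_def carrier_residues bij_betw_restrict_eq .
qed

lemma proj_exp_proj_perm:
  assumes "M \<in> carrier PGL2" and "i \<in> {0..int CARD('a)}"
  shows "proj_exp R P0 (proj_perm R P0 M i) = pgl_act M (proj_exp R P0 i)"
proof -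
  have "proj_exp R P0 (proj_log R P0 L) = L" if "L \<in> proj_line" for L
    unfolding proj_log_def carrier_residues using bij_proj_exp that
    by (simp add: f_inv_into_f bij_betw_def)
  then show ?thesis
    using assms unfolding proj_perm_def carrier_residues
    by (simp add: pgl_act_closed proj_exp_in_line)
qed

lemma inj_proj_perm: "inj_on (proj_perm R P0) (carrier PGL2)"
proof (rule inj_onI)
  fix M N :: "('a ^ 2 ^ 2) set"
  assume M: "M \<in> carrier PGL2" and N: "N \<in> carrier PGL2"
    and eq: "proj_perm R P0 M = proj_perm R P0 N"
  have "pgl_act M L = pgl_act N L" if "L \<in> proj_line" for L
  proof -
    have "L \<in> proj_exp R P0 ` {0..int CARD('a)}"
      unfolding bij_betw_imp_surj_on[OF bij_proj_exp] by (rule that)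
    then obtain i where i: "i \<in> {0..int CARD('a)}" "L = proj_exp R P0 i" by (rule imageE) simp
    show ?thesis
      unfolding i(2) proj_exp_proj_perm[OF M i(1), symmetric]
        proj_exp_proj_perm[OF N i(1), symmetric] eq ..
  qed
  then have "{L \<in> proj_line. pgl_act M L = pgl_act N L} = proj_line" by blast
  moreover have "card (proj_line :: ('a ^ 2) set set) = CARD('a) + 1"
    using bij_betw_same_card[OF bij_proj_exp] by simp
  ultimately show "M = N"
    using card_agreement_le_2[OF M N] card_field_ge_3 by fastforce
qed

text \<open>The element written \<open>J\<close> above. The order of \<open>R\<close> is even, so this is the only involution among
  its powers.\<close>

definition half_turn :: "('a ^ 2 ^ 2) set" where
  "half_turn = R [^]\<^bsub>PGL2\<^esub> ((CARD('a) + 1) div 2)"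

text \<open>The representatives of \<open>R\<close> and of the involution are obtained together, since the proofs
  below use that one is a power of the other.\<close>

lemma involution_matrix:
  obtains S d where "invertible S" and "R = proj S" and "eigenfree S"
    and "half_turn = proj (S [^]\<^bsub>GL2\<^esub> ((CARD('a) + 1) div 2))"
    and "eigenfree (S [^]\<^bsub>GL2\<^esub> ((CARD('a) + 1) div 2))"
    and "S [^]\<^bsub>GL2\<^esub> ((CARD('a) + 1) div 2) ** S [^]\<^bsub>GL2\<^esub> ((CARD('a) + 1) div 2) = mat d"
proof -
  obtain S where S: "invertible S" "R = proj S" "eigenfree S" by (rule singer_matrix)
  let ?k = "(CARD('a) + 1) div 2"
  let ?B = "S [^]\<^bsub>GL2\<^esub> ?k"
  have half_turn: "half_turn = proj ?B"
    unfolding half_turn_def by (rule proj_pow[OF S(1), folded S(2)])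
  have "half_turn \<noteq> \<one>\<^bsub>PGL2\<^esub>"
    using card_field_ge_3 unfolding half_turn_def R_pow_eq_one_iff by (auto dest: dvd_imp_le)
  then have "eigenfree ?B" using eigenfree_pow[OF S(3,1)] half_turn by simp
  moreover have "?k + ?k = CARD('a) + 1" using odd_card by presburger
  then have "half_turn \<otimes>\<^bsub>PGL2\<^esub> half_turn = \<one>\<^bsub>PGL2\<^esub>"
    by (simp only: half_turn_def PGL.nat_pow_mult[OF R_carrier] R_pow_eq_one_iff dvd_refl)
  then have "proj (?B ** ?B) = proj (mat 1)"
    by (simp only: half_turn proj_one
        proj_mult[OF GL2_pow_invertible[OF S(1)] GL2_pow_invertible[OF S(1)]])
  then obtain d where "?B ** ?B = mat d" by (auto simp: proj_eq_iff)
  ultimately show thesis using S half_turn by (intro that)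
qed

text \<open>Let \<open>A\<close>, \<open>B\<close> and \<open>T\<close> be matrices of \<open>M\<close>, of the involution and of \<open>R^v\<close>. The conjugate of
  \<open>B\<close> by \<open>A\<close> commutes with the conjugate of the matrix of \<open>R^u\<close>, that is, with a multiple of
  \<open>T\<close>. It and \<open>B\<close> thus lie in the field \<open>F[T]\<close> and have the same scalar square, so they
  agree up to sign.\<close>

lemma intertwiner_commutes_with_involution:
  fixes u v :: nat
  assumes M: "M \<in> carrier PGL2"
    and MR: "M \<otimes>\<^bsub>PGL2\<^esub> R [^]\<^bsub>PGL2\<^esub> u = R [^]\<^bsub>PGL2\<^esub> v \<otimes>\<^bsub>PGL2\<^esub> M"
    and u: "R [^]\<^bsub>PGL2\<^esub> u \<noteq> \<one>\<^bsub>PGL2\<^esub>"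
  shows "M \<otimes>\<^bsub>PGL2\<^esub> half_turn = half_turn \<otimes>\<^bsub>PGL2\<^esub> M"
proof -
  let ?k = "(CARD('a) + 1) div 2"
  obtain S d where S: "invertible S" "R = proj S" "eigenfree S" "half_turn = proj (S [^]\<^bsub>GL2\<^esub> ?k)"
      "S [^]\<^bsub>GL2\<^esub> ?k ** S [^]\<^bsub>GL2\<^esub> ?k = mat d"
    by (rule involution_matrix)
  define B U T where "B = S [^]\<^bsub>GL2\<^esub> ?k" and "U = S [^]\<^bsub>GL2\<^esub> u" and "T = S [^]\<^bsub>GL2\<^esub> v"
  obtain A where A: "invertible A" "M = proj A" using M by (rule PGL2_cases)
  then obtain A' where A': "A ** A' = mat 1" "A' ** A = mat 1" by (auto simp: invertible_def)
  have inv: "invertible B" "invertible U" "invertible T"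
    by (simp_all add: B_def U_def T_def GL2_pow_invertible S(1))
  have "R [^]\<^bsub>PGL2\<^esub> v \<noteq> \<one>\<^bsub>PGL2\<^esub>"
  proof
    assume "R [^]\<^bsub>PGL2\<^esub> v = \<one>\<^bsub>PGL2\<^esub>"
    with MR M have "M \<otimes>\<^bsub>PGL2\<^esub> R [^]\<^bsub>PGL2\<^esub> u = M" by simp
    with u M R_carrier show False by simp
  qed
  then have T: "eigenfree T"
    using eigenfree_pow[OF S(3,1)] by (simp add: T_def S(1,2) proj_pow)
  have BU: "B ** U = U ** B" and BT: "B ** T = T ** B"
    by (simp_all add: B_def U_def T_def GL2_pow_commute S(1))
  have "proj (A ** U) = proj (T ** A)"
    using MR A inv by (simp add: U_def T_def S(1,2) proj_pow proj_mult)
  then obtain c where c: "c \<noteq> 0" "A ** U = mat c ** (T ** A)" by (auto simp: proj_eq_iff)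
  have AU: "A *v (U *v x) = c *s (T *v (A *v x))" for x
    using c(2) by (metis mat_mult_mat_vec matrix_vector_mul_assoc)
  \<comment> \<open>\<open>T\<close> is, up to the factor \<open>c\<close>, the conjugate of \<open>U\<close> by \<open>A\<close>\<close>
  have TA: "T *v (A *v x) = A *v (U *v ((1 / c) *s x))" for x
    using c(1) by (simp add: AU vec.scale)
  have A'A: "A' *v (A *v x) = x" "A *v (A' *v x) = x" for x
    using A' by (simp_all add: matrix_vector_mul_assoc)
  define Y where "Y = A ** B ** A'"
  have Yv: "Y *v x = A *v (B *v (A' *v x))" for x
    by (simp add: Y_def matrix_vector_mul_assoc[symmetric])
  have BUv: "B *v (U *v x) = U *v (B *v x)" for x
    using BU by (metis matrix_vector_mul_assoc)
  have "Y ** T = T ** Y"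
    unfolding matrix_eq
  proof
    fix x
    have "T *v x = A *v (U *v ((1 / c) *s (A' *v x)))"
      using TA[of "A' *v x"] by (simp add: A'A)
    then show "(Y ** T) *v x = (T ** Y) *v x"
      by (simp add: matrix_vector_mul_assoc[symmetric] Yv A'A TA BUv vec.scale)
  qed
  moreover have "Y ** Y = mat d"
    using S(5) by (simp add: matrix_eq matrix_vector_mul_assoc[symmetric] Yv A'A mat_mult_vec
        vec.scale B_def)
  moreover have "B ** B = mat d" using S(5) by (simp add: B_def)
  ultimately have "Y = B \<or> Y = mat (-1) ** B"
    using commuting_square_roots_of_scalar[OF T _ BT] by blast
  then have "A ** B = mat 1 ** (B ** A) \<or> A ** B = mat (-1) ** (B ** A)"
    by (auto simp: matrix_eq matrix_vector_mul_assoc[symmetric] mat_mult_vec Yv) (metis A'A)+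
  then have "proj (A ** B) = proj (B ** A)"
    unfolding proj_eq_iff by (metis neg_equal_0_iff_equal zero_neq_one)
  moreover have "half_turn = proj B" unfolding B_def by (rule S(4))
  ultimately show ?thesis using A inv(1) by (simp add: proj_mult)
qed

lemma card_not_commuting:
  "int (card {M \<in> carrier PGL2. M \<otimes>\<^bsub>PGL2\<^esub> half_turn \<noteq> half_turn \<otimes>\<^bsub>PGL2\<^esub> M})
     = int CARD('a) * ((int CARD('a))\<^sup>2 - 1) - 2 * (int CARD('a) + 1)"
proof -
  let ?P = "carrier (PGL2 :: ('a ^ 2 ^ 2) set monoid)"
  let ?Cent = "{M \<in> ?P. M \<otimes>\<^bsub>PGL2\<^esub> half_turn = half_turn \<otimes>\<^bsub>PGL2\<^esub> M}"
  obtain S d where S: "invertible S" "half_turn = proj (S [^]\<^bsub>GL2\<^esub> ((CARD('a) + 1) div 2))"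
      "eigenfree (S [^]\<^bsub>GL2\<^esub> ((CARD('a) + 1) div 2))"
      "S [^]\<^bsub>GL2\<^esub> ((CARD('a) + 1) div 2) ** S [^]\<^bsub>GL2\<^esub> ((CARD('a) + 1) div 2) = mat d"
    by (rule involution_matrix)
  have cent: "card ?Cent = 2 * (CARD('a) + 1)"
    unfolding S(2) by (intro card_centralizer[OF odd_card _ S(3,4)] GL2_pow_invertible S(1))
  have "{M \<in> ?P. M \<otimes>\<^bsub>PGL2\<^esub> half_turn \<noteq> half_turn \<otimes>\<^bsub>PGL2\<^esub> M} = ?P - ?Cent" by blast
  moreover have "card ?Cent \<le> card ?P" by (intro card_mono) auto
  ultimately have "int (card {M \<in> ?P. M \<otimes>\<^bsub>PGL2\<^esub> half_turn \<noteq> half_turn \<otimes>\<^bsub>PGL2\<^esub> M})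
      = int (card ?P) - int (card ?Cent)"
    by (simp add: card_Diff_subset of_nat_diff)
  then show ?thesis
    by (simp add: cent card_PGL2 of_nat_diff)
qed

text \<open>Under the exponential map, adding \<open>u\<close> to a residue becomes applying \<open>R^u\<close>. The solutions
  of \<open>F (x + u) - F x = v\<close> therefore correspond to points on which \<open>M R^u\<close> and \<open>R^v M\<close> agree.
  There are at most two of them, as these projectivities are different.\<close>

lemma is_APN_proj_perm:
  assumes M: "M \<in> carrier PGL2" and MJ: "M \<otimes>\<^bsub>PGL2\<^esub> half_turn \<noteq> half_turn \<otimes>\<^bsub>PGL2\<^esub> M"
  shows "is_APN (CARD('a) + 1) (proj_perm R P0 M)"
proof (rule is_APN_permutationI)
  let ?F = "proj_perm R P0 M" and ?n = "int (CARD('a) + 1)"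
  show "bij_betw ?F {0..?n - 1} {0..?n - 1}" using bij_proj_perm[OF M] by simp
  fix u v
  assume u: "u \<in> {0..?n - 1}" "u \<noteq> 0" and v: "v \<in> {0..?n - 1}"
  let ?D = "{x \<in> {0..?n - 1}. (?F ((x + u) mod ?n) - ?F x) mod ?n = v}"
  let ?MR = "M \<otimes>\<^bsub>PGL2\<^esub> R [^]\<^bsub>PGL2\<^esub> u" and ?RM = "R [^]\<^bsub>PGL2\<^esub> v \<otimes>\<^bsub>PGL2\<^esub> M"
  have in_carrier: "?MR \<in> carrier PGL2" "?RM \<in> carrier PGL2"
    using M R_carrier by simp_all
  have "?MR \<noteq> ?RM"
  proof
    assume "?MR = ?RM"
    moreover have "R [^]\<^bsub>PGL2\<^esub> u = R [^]\<^bsub>PGL2\<^esub> nat u" "R [^]\<^bsub>PGL2\<^esub> v = R [^]\<^bsub>PGL2\<^esub> nat v"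
      using u v by (simp_all add: int_pow_int[symmetric])
    moreover have "R [^]\<^bsub>PGL2\<^esub> nat u \<noteq> \<one>\<^bsub>PGL2\<^esub>"
      unfolding R_pow_eq_one_iff using u by (auto dest: dvd_imp_le)
    ultimately show False
      using intertwiner_commutes_with_involution[OF M, of "nat u" "nat v"] MJ by simp
  qed
  have "proj_exp R P0 ` ?D \<subseteq> {L \<in> proj_line. pgl_act ?MR L = pgl_act ?RM L}"
  proof (intro image_subsetI CollectI conjI proj_exp_in_line)
    fix x
    assume "x \<in> ?D"
    then have x: "x \<in> {0..int CARD('a)}" and Fx: "(?F ((x + u) mod ?n) - ?F x) mod ?n = v" by auto
    have "?F ((x + u) mod ?n) mod ?n = (v + ?F x) mod ?n"
      unfolding Fx[symmetric] by (simp add: mod_add_left_eq)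
    then have F: "proj_exp R P0 (?F ((x + u) mod ?n)) = proj_exp R P0 (v + ?F x)"
      by (metis proj_exp_mod of_nat_1 of_nat_add)
    have "pgl_act ?MR (proj_exp R P0 x) = pgl_act M (proj_exp R P0 (u + x))"
      by (simp add: pgl_act_mult M R_carrier proj_exp_in_line proj_exp_add)
    also have "\<dots> = pgl_act M (proj_exp R P0 ((x + u) mod ?n))"
      using proj_exp_mod[of "x + u"] by (simp add: add.commute)
    also have "\<dots> = proj_exp R P0 (?F ((x + u) mod ?n))"
    proof (rule proj_exp_proj_perm[OF M, symmetric])
      have "?n > 0" by linarith
      from pos_mod_bound[OF this, of "x + u"] pos_mod_sign[OF this, of "x + u"]
      show "(x + u) mod ?n \<in> {0..int CARD('a)}" unfolding atLeastAtMost_iff by linarith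
    qed
    also have "\<dots> = pgl_act (R [^]\<^bsub>PGL2\<^esub> v) (pgl_act M (proj_exp R P0 x))"
      by (simp only: F proj_exp_add proj_exp_proj_perm[OF M x])
    also have "\<dots> = pgl_act ?RM (proj_exp R P0 x)"
      by (simp add: pgl_act_mult M R_carrier proj_exp_in_line)
    finally show "pgl_act ?MR (proj_exp R P0 x) = pgl_act ?RM (proj_exp R P0 x)" .
  qed
  then have "card (proj_exp R P0 ` ?D) \<le> card {L \<in> proj_line. pgl_act ?MR L = pgl_act ?RM L}"
    by (intro card_mono) auto
  also have "\<dots> \<le> 2" by (rule card_agreement_le_2[OF in_carrier \<open>?MR \<noteq> ?RM\<close>])
  also have "card (proj_exp R P0 ` ?D) = card ?D"
    using bij_proj_exp by (intro card_image) (auto simp: bij_betw_def intro: inj_on_subset)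
  finally show "card ?D \<le> 2" .
qed simp

end

theorem proposition1:
  fixes q :: nat
    and C :: "('a::{field,finite} ^ 2 ^ 2) set set"
    and R J :: "('a ^ 2 ^ 2) set"
    and P0 :: "('a ^ 2) set"
  assumes "q = CARD('a)" and "odd q"
    and "singer_group C"
    and "R \<in> C" and "C = generate PGL2 {R}"
    and "P0 \<in> proj_line"
    and "J = R [^]\<^bsub>PGL2\<^esub> ((q + 1) div 2)"
  shows "int (card {M \<in> carrier PGL2. M \<otimes>\<^bsub>PGL2\<^esub> J \<noteq> J \<otimes>\<^bsub>PGL2\<^esub> M})
           = int q * ((int q)\<^sup>2 - 1) - 2 * (int q + 1)
       \<and> (\<forall>M \<in> carrier PGL2.
             bij_betw (proj_perm R P0 M)
               (carrier (residue_ring (int (q + 1)))) (carrier (residue_ring (int (q + 1)))))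
       \<and> (\<forall>M \<in> carrier PGL2. M \<otimes>\<^bsub>PGL2\<^esub> J \<noteq> J \<otimes>\<^bsub>PGL2\<^esub> M
             \<longrightarrow> is_APN (q + 1) (proj_perm R P0 M))
       \<and> inj_on (proj_perm R P0) (carrier PGL2)"
proof -
  have C: "subgroup C PGL2" "card C = CARD('a) + 1"
    using assms(3) by (simp_all add: singer_group_def)
  have R: "R \<in> carrier PGL2" using subgroup.subset[OF C(1)] assms(4) by blast
  have "group.ord PGL2 R = CARD('a) + 1"
    using group.generate_pow_card[OF group_PGL2 R] C(2) assms(5) by simp
  then interpret singer_cycle R P0
    using R assms(1,2,6) by unfold_locales auto
  have J: "J = half_turn" using assms(1,7) by (simp add: half_turn_def)
  show ?thesis
    using card_not_commuting bij_proj_perm is_APN_proj_perm inj_proj_perm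
    unfolding J assms(1) carrier_residues by blast
qed

end
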